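(* Let $(\mathcal A,\mathcal H,D)$ be a spectral triple with $\mathcal A$ unital, and let $\prec\cdot\succ$ be a collection of multilinear maps $\mathcal B(\mathcal H)^{\times n}\to\mathbb C$, $n\in\mathbb N$ ($n\ge1$), such that for all $n\ge1$, $V_1,\dots,V_n\in\mathcal B(\mathcal H)$ and $a\in\mathcal A$: (I) $\prec V_1,\dots,V_n\succ\,=\,\prec V_n,V_1,\dots,V_{n-1}\succ$; (II) $\prec aV_1,V_2,\dots,V_n\succ-\prec V_1,\dots,V_{n-1},V_na\succ\,=\,\prec V_1,\dots,V_n,[D,a]\succ$. Define for $a_0,\dots,a_n\in\mathcal A$ $$\phi_n(a_0,\dots,a_n):=\,\prec a_0[D,a_1],[D,a_2],\dots,[D,a_n]\succ\quad(n\ge1),\qquad \phi_0:=0,$$ and for $k\ge1$ $$\psi_{2k-1}:=\phi_{2k-1}-\tfrac12B_0\phi_{2k},\qquad \tilde\psi_{2k-1}:=(-1)^{k-1}\frac{(k-1)!}{(2k-1)!}\,\psi_{2k-1}.$$ Then: (i) the sequence $(\phi_{2k})$ is a $(b,B)$-cocycle, and each $\phi_{2k}$ defines an even Hochschild cocycle: $b\phi_{2k}=0$; (ii) the sequence $(\tilde\psi_{2k-1})$ is an odd $(b,B)$-cocycle.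
   Context: A spectral triple $(\mathcal A,\mathcal H,D)$ consists of a $*$-algebra $\mathcal A$ represented by bounded operators on a Hilbert space $\mathcal H$ and a self-adjoint operator $D$ in $\mathcal H$ with compact resolvent such that $[D,a]$ extends to a bounded operator for all $a\in\mathcal A$. $\mathcal C^n(\mathcal A)$ is the space of $(n+1)$-linear functionals $\phi$ on $\mathcal A$ with $\phi(a_0,\dots,a_n)=0$ whenever $a_j=1$ for some $j\ge1$ (Hochschild $n$-cochains). Define $b:\mathcal C^n(\mathcal A)\to\mathcal C^{n+1}(\mathcal A)$ and $B:\mathcal C^{n+1}(\mathcal A)\to\mathcal C^n(\mathcal A)$ by $$b\phi(a_0,\dots,a_{n+1})=\sum_{j=0}^n(-1)^j\phi(a_0,\dots,a_ja_{j+1},\dots,a_{n+1})+(-1)^{n+1}\phi(a_{n+1}a_0,a_1,\dots,a_n),$$ $$B\phi(a_0,\dots,a_n)=\sum_{j=0}^n(-1)^{nj}\phi(1,a_j,a_{j+1},\dots,a_{j-1})$$ (indices cyclic), and $B_0\phi(a_0,\dots,a_n)=\phi(1,a_0,\dots,a_n)$ for $\phi\in\mathcal C^{n+1}(\mathcal A)$. An odd $(b,B)$-cocycle is a (possibly infinite) sequence $(\phi_1,\phi_3,\dots)$ with $\phi_{2k+1}\in\mathcal C^{2k+1}(\mathcal A)$, $b\phi_{2k+1}+B\phi_{2k+3}=0$ for all $k\ge0$, and $B\phi_1=0$. An even $(b,B)$-cocycle is, analogously, a (possibly infinite) sequence $(\phi_0,\phi_2,\dots)$ with $\phi_{2k}\in\mathcal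 C^{2k}(\mathcal A)$ and $b\phi_{2k}+B\phi_{2k+2}=0$ for all $k\ge0$.
   Formalization: In (ii), Bψ̃_1=0 does not follow from (I), (II), since Bψ̃_1(a)=≺[D,a]≻ can be nonzero; so proved instead: the ψ̃ are cochains with bψ̃_{2k-1}+Bψ̃_{2k+1}=0 for k≥1, and they form an odd (b,B)-cocycle iff ≺[D,a]≻=0 for all a. The unit of A acts as the identity. *)

theory Defs
  imports "HOL-Analysis.Analysis"
begin

class scaleC =
  fixes scaleC :: "complex \<Rightarrow> 'a \<Rightarrow> 'a" (infixr "*\<^sub>C" 75)

class complex_vector = ab_group_add + scaleC +
  assumes scaleC_add_right: "c *\<^sub>C (x + y) = c *\<^sub>C x + c *\<^sub>C y"
    and scaleC_add_left: "(c + d) *\<^sub>C x = c *\<^sub>C x + d *\<^sub>C x"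
    and scaleC_scaleC: "c *\<^sub>C (d *\<^sub>C x) = (c * d) *\<^sub>C x"
    and scaleC_one: "1 *\<^sub>C x = x"

(* Built on ring + monoid_mult and not on ring_1, so that the zero algebra is allowed. *)
class complex_unital_algebra = complex_vector + ring + monoid_mult +
  assumes mult_scaleC_left: "(c *\<^sub>C x) * y = c *\<^sub>C (x * y)"
    and mult_scaleC_right: "x * (c *\<^sub>C y) = c *\<^sub>C (x * y)"

class complex_star_algebra = complex_unital_algebra +
  fixes star :: "'a \<Rightarrow> 'a"
  assumes star_add: "star (x + y) = star x + star y"
    and star_scaleC: "star (c *\<^sub>C x) = cnj c *\<^sub>C star x"
    and star_mult: "star (x * y) = star y * star x"
    and star_star: "star (star x) = x"

(* The inner product is linear in the second argument. Definiteness follows from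
   cinner_self and the norm axioms; completeness is part of the class banach. *)
class complex_hilbert = complex_vector + banach +
  fixes cinner :: "'a \<Rightarrow> 'a \<Rightarrow> complex"
  assumes scaleR_scaleC: "r *\<^sub>R x = complex_of_real r *\<^sub>C x"
    and cinner_add_right: "cinner x (y + z) = cinner x y + cinner x z"
    and cinner_scaleC_right: "cinner x (c *\<^sub>C y) = c * cinner x y"
    and cinner_commute: "cinner y x = cnj (cinner x y)"
    and cinner_self: "cinner x x = complex_of_real ((norm x)\<^sup>2)"

lemma scaleC_zero_right [simp]: "c *\<^sub>C (0 :: 'a :: complex_vector) = 0"
  using scaleC_add_right[of c 0 0] by simp

lemma scaleC_minus_right: "c *\<^sub>C (- x :: 'a :: complex_vector) = - (c *\<^sub>C x)"
  using scaleC_add_right[of c x "- x"] by (simp add: eq_neg_iff_add_eq_0 add.commute)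

lemma scaleC_diff_right: "c *\<^sub>C (x - y :: 'a :: complex_vector) = c *\<^sub>C x - c *\<^sub>C y"
  using scaleC_add_right[of c x "- y"] by (simp add: scaleC_minus_right)

lemma norm_scaleC: "norm (c *\<^sub>C (x :: 'h :: complex_hilbert)) = cmod c * norm x"
proof -
  have "cinner (c *\<^sub>C x) (c *\<^sub>C x) = c * cnj (c * cinner x x)"
    by (metis cinner_scaleC_right cinner_commute)
  also have "\<dots> = (c * cnj c) * cnj (cinner x x)" by simp
  also have "\<dots> = complex_of_real ((cmod c * norm x)\<^sup>2)"
    by (simp add: cinner_self power_mult_distrib flip: complex_norm_square)
  finally have "(norm (c *\<^sub>C x))\<^sup>2 = (cmod c * norm x)\<^sup>2"
    by (simp only: cinner_self of_real_eq_iff)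
  then show ?thesis by (simp add: power2_eq_iff_nonneg)
qed

lemma bounded_linear_scaleC_right: "bounded_linear (\<lambda>x :: 'h :: complex_hilbert. c *\<^sub>C x)"
  by (rule bounded_linear_intro[where K = "cmod c"])
    (simp_all add: scaleC_add_right scaleR_scaleC scaleC_scaleC mult.commute norm_scaleC)

section \<open>The algebra of bounded operators\<close>

typedef (overloaded) 'h bop =
  "{T :: 'h \<Rightarrow> 'h :: complex_hilbert. bounded_linear T \<and> (\<forall>c x. T (c *\<^sub>C x) = c *\<^sub>C T x)}"
  morphisms bop_apply Abs_bop
  by (rule exI[of _ "\<lambda>x. x"]) (simp add: bounded_linear_ident)

setup_lifting type_definition_bop

instantiation bop :: (complex_hilbert) complex_unital_algebra
begin

lift_definition zero_bop :: "'a bop" is "\<lambda>x. 0"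
  by (simp add: bounded_linear_zero)

lift_definition one_bop :: "'a bop" is "\<lambda>x. x"
  by (simp add: bounded_linear_ident)

lift_definition plus_bop :: "'a bop \<Rightarrow> 'a bop \<Rightarrow> 'a bop" is "\<lambda>S T x. S x + T x"
  by (simp add: bounded_linear_add scaleC_add_right)

lift_definition minus_bop :: "'a bop \<Rightarrow> 'a bop \<Rightarrow> 'a bop" is "\<lambda>S T x. S x - T x"
  by (simp add: bounded_linear_sub scaleC_diff_right)

lift_definition uminus_bop :: "'a bop \<Rightarrow> 'a bop" is "\<lambda>T x. - T x"
  by (simp add: bounded_linear_minus scaleC_minus_right)

lift_definition times_bop :: "'a bop \<Rightarrow> 'a bop \<Rightarrow> 'a bop" is "\<lambda>S T x. S (T x)"
  by (simp add: bounded_linear_compose)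

lift_definition scaleC_bop :: "complex \<Rightarrow> 'a bop \<Rightarrow> 'a bop" is "\<lambda>c T x. c *\<^sub>C T x"
  by (auto intro: bounded_linear_compose[OF bounded_linear_scaleC_right]
      simp: scaleC_scaleC mult.commute)

instance
  by standard
    (transfer; force simp: scaleC_add_right scaleC_add_left scaleC_scaleC scaleC_one
      bounded_linear.linear linear_add)+

end

section \<open>Spectral triples\<close>

(* The representation is unital: the unit of the algebra acts as the identity.
   It need not be faithful. *)
definition star_representation ::
  "('a :: complex_star_algebra \<Rightarrow> 'h :: complex_hilbert bop) \<Rightarrow> bool" where
  "star_representation \<pi> \<longleftrightarrow>
     (\<forall>a b. \<pi> (a + b) = \<pi> a + \<pi> b) \<and>
     (\<forall>c a. \<pi> (c *\<^sub>C a) = c *\<^sub>C \<pi> a) \<and>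
     (\<forall>a b. \<pi> (a * b) = \<pi> a * \<pi> b) \<and>
     \<pi> 1 = 1 \<and>
     (\<forall>a x y. cinner (bop_apply (\<pi> (star a)) x) y = cinner x (bop_apply (\<pi> a) y))"

(* An unbounded operator is given by its domain and a function of which only the
   values on the domain matter. *)
definition linear_operator_on :: "'h :: complex_hilbert set \<Rightarrow> ('h \<Rightarrow> 'h) \<Rightarrow> bool" where
  "linear_operator_on domD D \<longleftrightarrow>
     0 \<in> domD \<and>
     (\<forall>x\<in>domD. \<forall>y\<in>domD. x + y \<in> domD \<and> D (x + y) = D x + D y) \<and>
     (\<forall>c. \<forall>x\<in>domD. c *\<^sub>C x \<in> domD \<and> D (c *\<^sub>C x) = c *\<^sub>C D x)"

definition adjoint_graph :: "'h :: complex_hilbert set \<Rightarrow> ('h \<Rightarrow> 'h) \<Rightarrow> ('h \<times> 'h) set" where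
  "adjoint_graph domD D = {(y, z). \<forall>x\<in>domD. cinner y (D x) = cinner z x}"

definition self_adjoint :: "'h :: complex_hilbert set \<Rightarrow> ('h \<Rightarrow> 'h) \<Rightarrow> bool" where
  "self_adjoint domD D \<longleftrightarrow>
     linear_operator_on domD D \<and> closure domD = UNIV \<and>
     adjoint_graph domD D = {(x, D x) | x. x \<in> domD}"

definition is_resolvent ::
  "'h :: complex_hilbert set \<Rightarrow> ('h \<Rightarrow> 'h) \<Rightarrow> complex \<Rightarrow> 'h bop \<Rightarrow> bool" where
  "is_resolvent domD D z R \<longleftrightarrow>
     (\<forall>x\<in>domD. bop_apply R (D x - z *\<^sub>C x) = x) \<and>
     (\<forall>y. bop_apply R y \<in> domD \<and> D (bop_apply R y) - z *\<^sub>C bop_apply R y = y)"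

definition compact_operator :: "'h :: complex_hilbert bop \<Rightarrow> bool" where
  "compact_operator T \<longleftrightarrow> compact (closure (bop_apply T ` cball 0 1))"

(* By the resolvent identity, one compact resolvent makes all of them compact. *)
definition compact_resolvent :: "'h :: complex_hilbert set \<Rightarrow> ('h \<Rightarrow> 'h) \<Rightarrow> bool" where
  "compact_resolvent domD D \<longleftrightarrow> (\<exists>z R. is_resolvent domD D z R \<and> compact_operator R)"

definition extends_commutator ::
  "'h :: complex_hilbert set \<Rightarrow> ('h \<Rightarrow> 'h) \<Rightarrow> 'h bop \<Rightarrow> 'h bop \<Rightarrow> bool" where
  "extends_commutator domD D T C \<longleftrightarrow>
     (\<forall>x\<in>domD. bop_apply T x \<in> domD \<and> bop_apply C x = D (bop_apply T x) - bop_apply T (D x))"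

definition spectral_triple ::
  "('a :: complex_star_algebra \<Rightarrow> 'h :: complex_hilbert bop) \<Rightarrow> 'h set \<Rightarrow> ('h \<Rightarrow> 'h) \<Rightarrow> bool" where
  "spectral_triple \<pi> domD D \<longleftrightarrow>
     star_representation \<pi> \<and> self_adjoint domD D \<and> compact_resolvent domD D \<and>
     (\<forall>a. \<exists>C. extends_commutator domD D (\<pi> a) C)"

(* The bounded operator [D, a]; for a spectral triple it is unique because domD is dense. *)
definition commD ::
  "('a :: complex_star_algebra \<Rightarrow> 'h :: complex_hilbert bop) \<Rightarrow> 'h set \<Rightarrow> ('h \<Rightarrow> 'h) \<Rightarrow> 'a \<Rightarrow> 'h bop"
  where "commD \<pi> domD D a = (THE C. extends_commutator domD D (\<pi> a) C)"

section \<open>Cochains and the operators b and B\<close>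

(* A function of n arguments is a function on lists, considered on lists of length n only. *)
definition multilinear :: "nat \<Rightarrow> ('v :: complex_vector list \<Rightarrow> complex) \<Rightarrow> bool" where
  "multilinear n F \<longleftrightarrow>
     (\<forall>xs i. length xs = n \<and> i < n \<longrightarrow>
        (\<forall>x y. F (xs[i := x + y]) = F (xs[i := x]) + F (xs[i := y])) \<and>
        (\<forall>c x. F (xs[i := c *\<^sub>C x]) = c * F (xs[i := x])))"

(* An n-cochain takes the n + 1 arguments a_0, ..., a_n. *)
definition cochain :: "nat \<Rightarrow> ('a :: complex_unital_algebra list \<Rightarrow> complex) \<Rightarrow> bool" where
  "cochain n \<phi> \<longleftrightarrow>
     multilinear (n + 1) \<phi> \<and>
     (\<forall>as j. length as = n + 1 \<and> 1 \<le> j \<and> j \<le> n \<and> as ! j = 1 \<longrightarrow> \<phi> as = 0)"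

(* The index n is that of the source: an n-cochain is sent to an (n+1)-cochain. *)
definition hoch_b ::
  "nat \<Rightarrow> ('a :: complex_unital_algebra list \<Rightarrow> complex) \<Rightarrow> 'a list \<Rightarrow> complex" where
  "hoch_b n \<phi> as =
     (\<Sum>j=0..n. (- 1) ^ j * \<phi> (take j as @ [as ! j * as ! (j + 1)] @ drop (j + 2) as)) +
     (- 1) ^ (n + 1) * \<phi> ((as ! (n + 1) * as ! 0) # drop 1 (take (n + 1) as))"

definition connes_B0 ::
  "('a :: complex_unital_algebra list \<Rightarrow> complex) \<Rightarrow> 'a list \<Rightarrow> complex" where
  "connes_B0 \<phi> as = \<phi> (1 # as)"

(* The index n is that of the target: an (n+1)-cochain is sent to an n-cochain. *)
definition connes_B ::
  "nat \<Rightarrow> ('a :: complex_unital_algebra list \<Rightarrow> complex) \<Rightarrow> 'a list \<Rightarrow> complex" where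
  "connes_B n \<phi> as = (\<Sum>j=0..n. (- 1) ^ (n * j) * \<phi> (1 # rotate j as))"

(* Component k of the sequence has degree 2k. *)
definition even_bB_cocycle ::
  "(nat \<Rightarrow> 'a :: complex_unital_algebra list \<Rightarrow> complex) \<Rightarrow> bool" where
  "even_bB_cocycle \<Phi> \<longleftrightarrow>
     (\<forall>k. cochain (2 * k) (\<Phi> k)) \<and>
     (\<forall>k as. length as = 2 * k + 2 \<longrightarrow>
        hoch_b (2 * k) (\<Phi> k) as + connes_B (2 * k + 1) (\<Phi> (k + 1)) as = 0)"

(* Component k of the sequence has degree 2k + 1. *)
definition odd_bB_cocycle ::
  "(nat \<Rightarrow> 'a :: complex_unital_algebra list \<Rightarrow> complex) \<Rightarrow> bool" where
  "odd_bB_cocycle \<Psi> \<longleftrightarrow>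
     (\<forall>k. cochain (2 * k + 1) (\<Psi> k)) \<and>
     (\<forall>k as. length as = 2 * k + 3 \<longrightarrow>
        hoch_b (2 * k + 1) (\<Psi> k) as + connes_B (2 * k + 2) (\<Psi> (k + 1)) as = 0) \<and>
     (\<forall>as. length as = 1 \<longrightarrow> connes_B 0 (\<Psi> 0) as = 0)"

section \<open>The cochains of a bracket\<close>

definition phi ::
  "('a :: complex_star_algebra \<Rightarrow> 'h :: complex_hilbert bop) \<Rightarrow> 'h set \<Rightarrow> ('h \<Rightarrow> 'h) \<Rightarrow>
   ('h bop list \<Rightarrow> complex) \<Rightarrow> nat \<Rightarrow> 'a list \<Rightarrow> complex" where
  "phi \<pi> domD D br n as =
     (if n = 0 then 0
      else br ((\<pi> (as ! 0) * commD \<pi> domD D (as ! 1)) # map (commD \<pi> domD D) (drop 2 as)))"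

(* Notation: <V_1, ..., V_n> is br [V_1, ..., V_n].
   The degree 0 condition on the odd sequence, B psi_tilde_1 (a) = 0, says <[D, a]> = 0.
   Cyclicity and the commutator rule for n >= 1 do not imply this. On l^2(Z) let
   D e_n = n e_n, let the algebra be generated by the shift u and its inverse, and set
   <V> = m (n |-> (e_{n+1}, V e_n)) for a shift-invariant mean m on bounded sequences,
   with all brackets of length >= 2 zero. Then <a V> = <V a> for a in the algebra, so both
   rules hold, but [D, u] = u and <u> = 1. *)
(* psi k and psi_tilde k, for k \<ge> 1, are the cochains of degree 2k - 1. *)
definition psi ::
  "('a :: complex_star_algebra \<Rightarrow> 'h :: complex_hilbert bop) \<Rightarrow> 'h set \<Rightarrow> ('h \<Rightarrow> 'h) \<Rightarrow>
   ('h bop list \<Rightarrow> complex) \<Rightarrow> nat \<Rightarrow> 'a list \<Rightarrow> complex" where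
  "psi \<pi> domD D br k as =
     phi \<pi> domD D br (2 * k - 1) as - 1 / 2 * connes_B0 (phi \<pi> domD D br (2 * k)) as"

definition psi_tilde ::
  "('a :: complex_star_algebra \<Rightarrow> 'h :: complex_hilbert bop) \<Rightarrow> 'h set \<Rightarrow> ('h \<Rightarrow> 'h) \<Rightarrow>
   ('h bop list \<Rightarrow> complex) \<Rightarrow> nat \<Rightarrow> 'a list \<Rightarrow> complex" where
  "psi_tilde \<pi> domD D br k as =
     (- 1) ^ (k - 1) * (fact (k - 1) / fact (2 * k - 1)) * psi \<pi> domD D br k as"

end

theory Submission
  imports Defs
begin

text \<open>
  Write \<open>\<delta> a = [D, a]\<close>. Applied to a bracket with a factor \<open>a\<close> between two neighbouring
  entries, rules (I) and (II) say that moving \<open>a\<close> from one entry to the next costs one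
  bracket in which \<open>\<delta> a\<close> is inserted between them. As \<open>\<delta>\<close> is a derivation, the Hochschild
  coboundary of \<open>\<phi>\<^sub>n\<close> telescopes to \<open>n\<close> copies of \<open>\<phi>\<^sub>n\<^sub>+\<^sub>1\<close> with alternating signs, so
  \<open>b \<phi>\<^sub>2\<^sub>k = 0\<close> and \<open>b \<phi>\<^sub>2\<^sub>k\<^sub>-\<^sub>1 = \<phi>\<^sub>2\<^sub>k\<close>. The same computation for the cyclic cochain
  \<open>B\<^sub>0 \<phi>\<^sub>2\<^sub>k\<close> yields \<open>b B\<^sub>0 \<phi>\<^sub>2\<^sub>k = 2 \<phi>\<^sub>2\<^sub>k - B\<^sub>0 \<phi>\<^sub>2\<^sub>k\<^sub>+\<^sub>1\<close>, hence
  \<open>b \<psi>\<^sub>2\<^sub>k\<^sub>-\<^sub>1 = B\<^sub>0 \<phi>\<^sub>2\<^sub>k\<^sub>+\<^sub>1 / 2\<close>. By cyclicity \<open>B \<phi>\<^sub>2\<^sub>k = 0\<close> and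
  \<open>B \<psi>\<^sub>2\<^sub>k\<^sub>+\<^sub>1 = (2k + 1) B\<^sub>0 \<phi>\<^sub>2\<^sub>k\<^sub>+\<^sub>1\<close>, which the normalisation of \<open>\<psi>\<close> balances.
\<close>

section \<open>Linearity of b, B and of the cochain condition\<close>

text \<open>Kept apart from \<open>hoch_b\<close> for its recursion on the list: the rules for
  \<open>0\<close> and \<open>Suc\<close> below peel off the leading arguments, which share the
  first slot of a bracket.\<close>

definition contract :: "nat \<Rightarrow> 'a :: complex_unital_algebra list \<Rightarrow> 'a list" where
  "contract j as = take j as @ [as ! j * as ! (j + 1)] @ drop (j + 2) as"

lemma contract_0 [simp]: "contract 0 (a # b # as) = (a * b) # as"
  by (simp add: contract_def)

lemma contract_Suc [simp]: "contract (Suc j) (a # as) = a # contract j as"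
  by (simp add: contract_def)

lemma contract_append: "length us = j \<Longrightarrow> contract j (us @ b # c # ws) = us @ (b * c) # ws"
  by (simp add: contract_def nth_append)

lemma length_contract: "Suc j < length as \<Longrightarrow> length (contract j as) = length as - 1"
  by (simp add: contract_def)

lemma hoch_b_contract:
  "hoch_b n \<phi> as = (\<Sum>j=0..n. (- 1) ^ j * \<phi> (contract j as)) +
     (- 1) ^ (n + 1) * \<phi> ((as ! (n + 1) * as ! 0) # drop 1 (take (n + 1) as))"
  by (simp add: hoch_b_def contract_def)

text \<open>Cochains are functions on all lists, of which only the values at length
  \<open>n + 1\<close> count; every term of b evaluates them there.\<close>

lemma hoch_b_cong:
  assumes "\<And>bs. length bs = n + 1 \<Longrightarrow> \<phi> bs = \<psi> bs" "length as = n + 2"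
  shows "hoch_b n \<phi> as = hoch_b n \<psi> as"
  unfolding hoch_b_contract using assms by (auto simp: length_contract intro!: sum.cong)

lemma hoch_b_diff: "hoch_b n (\<lambda>as. \<phi> as - \<psi> as) as = hoch_b n \<phi> as - hoch_b n \<psi> as"
  by (simp add: hoch_b_def algebra_simps sum_subtractf)

lemma hoch_b_mult: "hoch_b n (\<lambda>as. c * \<phi> as) as = c * hoch_b n \<phi> as"
  by (simp add: hoch_b_def algebra_simps sum_distrib_left)

lemma connes_B_cong:
  assumes "\<And>bs. length bs = n + 1 \<Longrightarrow> \<phi> (1 # bs) = \<psi> (1 # bs)" "length as = n + 1"
  shows "connes_B n \<phi> as = connes_B n \<psi> as"
  unfolding connes_B_def using assms by (intro sum.cong) auto

lemma connes_B_mult: "connes_B n (\<lambda>as. c * \<phi> as) as = c * connes_B n \<phi> as"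
  by (simp add: connes_B_def algebra_simps sum_distrib_left)

text \<open>Only the signs are left to be summed: all are 1 for even \<open>n\<close>, and for odd
  \<open>n\<close> an even number of alternating signs cancels.\<close>

lemma connes_B_cyclic:
  assumes "\<And>j. \<phi> (1 # rotate j as) = c"
  shows "connes_B n \<phi> as = (if even n then of_nat (n + 1) * c else 0)"
proof -
  have "connes_B n \<phi> as = (\<Sum>j=0..n. (- 1) ^ (n * j)) * c"
    by (simp add: connes_B_def assms sum_distrib_right)
  moreover have "(\<Sum>j=0..n. (- 1 :: complex) ^ (n * j)) = (if even n then of_nat (n + 1) else 0)"
  proof (cases "even n")
    case False
    have "(\<Sum>j=0..m. (- 1 :: complex) ^ j) = (if even m then 1 else 0)" for m
      by (induction m) auto
    then show ?thesis using False by (simp add: power_mult)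
  qed (simp add: power_mult)
  ultimately show ?thesis by auto
qed

lemma multilinear_cong:
  assumes "\<And>as. length as = n \<Longrightarrow> \<phi> as = \<psi> as" "multilinear n \<psi>"
  shows "multilinear n \<phi>"
  using assms unfolding multilinear_def by simp

lemma multilinear_diff:
  "multilinear n \<phi> \<Longrightarrow> multilinear n \<psi> \<Longrightarrow> multilinear n (\<lambda>as. \<phi> as - \<psi> as)"
  unfolding multilinear_def by (simp add: algebra_simps)

lemma multilinear_mult: "multilinear n \<phi> \<Longrightarrow> multilinear n (\<lambda>as. c * \<phi> as)"
  unfolding multilinear_def by (simp add: algebra_simps)

lemma multilinear_zero_entry:
  assumes "multilinear n F" "length xs = n" "i < n" "xs ! i = 0"
  shows "F xs = 0"
proof -
  have "F (xs[i := 0 + 0]) = F (xs[i := 0]) + F (xs[i := 0])"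
    using assms unfolding multilinear_def by blast
  then show ?thesis using assms(4) by (metis add_0 add_cancel_right_right list_update_id)
qed

lemma cochain_cong:
  assumes "\<And>as. length as = n + 1 \<Longrightarrow> \<phi> as = \<psi> as" "cochain n \<psi>"
  shows "cochain n \<phi>"
  using assms multilinear_cong[of "n + 1" \<phi> \<psi>] unfolding cochain_def by simp

lemma cochain_diff: "cochain n \<phi> \<Longrightarrow> cochain n \<psi> \<Longrightarrow> cochain n (\<lambda>as. \<phi> as - \<psi> as)"
  unfolding cochain_def by (simp add: multilinear_diff)

lemma cochain_mult: "cochain n \<phi> \<Longrightarrow> cochain n (\<lambda>as. c * \<phi> as)"
  unfolding cochain_def by (simp add: multilinear_mult)

text \<open>The \<open>t\<close> terms cancel between neighbouring summands and the copies of
  \<open>C\<close> in pairs. Summands of this shape come from the Leibniz rule in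
  \<open>br_contract_sum\<close>.\<close>

lemma sum_alternating_telescope:
  fixes t :: "nat \<Rightarrow> 'a :: comm_ring_1"
  shows "(\<Sum>j<m. (- 1) ^ j * (t j + t (Suc j) + C)) =
    t 0 - (- 1) ^ m * t m + (if odd m then C else 0)"
  by (induction m) (auto simp: algebra_simps)

lemma sum_alternating_shift:
  fixes f :: "nat \<Rightarrow> 'a :: comm_ring_1"
  shows "(\<Sum>j<Suc n. (- 1) ^ j * f j) = f 0 - (\<Sum>j<n. (- 1) ^ j * f (Suc j))"
  by (induction n) auto

section \<open>Brackets of a derivation\<close>

text \<open>Separates the algebra from the analysis: \<open>\<delta>\<close> stands for the
  commutator with D, a derivation along \<open>\<pi>\<close>. For a single entry,
  \<open>hd Vs\<close> and \<open>last Vs\<close> coincide and rule (II) reads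
  \<open>br [\<pi> a * V] - br [V * \<pi> a] = br [V, \<delta> a]\<close>.\<close>

locale derivation_bracket =
  fixes \<pi> \<delta> :: "'a :: complex_unital_algebra \<Rightarrow> 'b :: complex_unital_algebra"
    and br :: "'b list \<Rightarrow> complex"
  assumes \<pi>_add: "\<pi> (a + b) = \<pi> a + \<pi> b"
    and \<pi>_scaleC: "\<pi> (c *\<^sub>C a) = c *\<^sub>C \<pi> a"
    and \<pi>_mult: "\<pi> (a * b) = \<pi> a * \<pi> b"
    and \<pi>_one: "\<pi> 1 = 1"
    and \<delta>_add: "\<delta> (a + b) = \<delta> a + \<delta> b"
    and \<delta>_scaleC: "\<delta> (c *\<^sub>C a) = c *\<^sub>C \<delta> a"
    and \<delta>_mult: "\<delta> (a * b) = \<delta> a * \<pi> b + \<pi> a * \<delta> b"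
    and br_multilinear: "n \<ge> 1 \<Longrightarrow> multilinear n br"
    and br_cyclic: "length Vs \<ge> 1 \<Longrightarrow> br Vs = br (last Vs # butlast Vs)"
    and br_commutator: "length Vs \<ge> 1 \<Longrightarrow>
      br ((\<pi> a * hd Vs) # tl Vs) - br (butlast Vs @ [last Vs * \<pi> a]) = br (Vs @ [\<delta> a])"
begin

section \<open>Calculus of brackets: additivity, rotation, and moving algebra elements\<close>

lemma \<delta>_one: "\<delta> 1 = 0"
  using \<delta>_mult[of 1 1] by (simp add: \<pi>_one)

lemma br_update_add:
  "i < length xs \<Longrightarrow> br (xs[i := x + y]) = br (xs[i := x]) + br (xs[i := y])"
  using br_multilinear[of "length xs"] unfolding multilinear_def by auto

lemma br_update_scaleC: "i < length xs \<Longrightarrow> br (xs[i := c *\<^sub>C x]) = c * br (xs[i := x])"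
  using br_multilinear[of "length xs"] unfolding multilinear_def by auto

lemma br_add: "br (us @ (x + y) # vs) = br (us @ x # vs) + br (us @ y # vs)"
  using br_update_add[of "length us" "us @ x # vs" x y] by simp

lemma br_add_hd: "br ((x + y) # vs) = br (x # vs) + br (y # vs)"
  using br_add[of "[]"] by simp

lemma br_zero: "0 \<in> set xs \<Longrightarrow> br xs = 0"
  using multilinear_zero_entry[OF br_multilinear[of "length xs"]]
  by (metis in_set_conv_nth less_one linorder_not_less not_less_zero)

text \<open>Rule (I) carries the last entry to the front; doing this for the entries of
  \<open>vs\<close> one by one, from the end, carries the whole block.\<close>

lemma br_append_commute: "br (us @ vs) = br (vs @ us)"
proof (induction vs arbitrary: us rule: rev_induct)
  case (snoc v vs)
  have "br (us @ vs @ [v]) = br ((v # us) @ vs)"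
    using br_cyclic[of "us @ vs @ [v]"] by (simp add: butlast_append)
  then show ?case using snoc[of "v # us"] by simp
qed simp

lemma br_rotate: "br (rotate j Vs) = br Vs"
  unfolding rotate_drop_take
  by (metis append_take_drop_id br_append_commute)

text \<open>Rule (II) links the first and the last entry. Rotating the bracket until
  \<open>V\<close> is last and \<open>\<pi> a * W\<close> first applies it to interior
  neighbours.\<close>

lemma br_move:
  "br (us @ V # (\<pi> a * W) # vs) = br (us @ (V * \<pi> a) # W # vs) + br (us @ V # \<delta> a # W # vs)"
proof -
  have "br ((\<pi> a * W # vs) @ us @ [V]) - br ((W # vs @ us) @ [V * \<pi> a]) =
      br ((W # vs) @ us @ [V, \<delta> a])"
    using br_commutator[of "W # vs @ us @ [V]" a] by (simp add: butlast_append)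
  then show ?thesis
    using br_append_commute[of "\<pi> a * W # vs" "us @ [V]"]
      br_append_commute[of "W # vs" "us @ [V * \<pi> a]"]
      br_append_commute[of "W # vs" "us @ [V, \<delta> a]"] by (simp add: diff_eq_eq add.commute)
qed

text \<open>The same move across the seam of the list, in the form needed for the cyclic term of
  b.\<close>

lemma br_move_cyclic:
  "br ((\<pi> a * V) # Vs) =
     br (butlast (V # Vs) @ [last (V # Vs) * \<pi> a]) + br (V # Vs @ [\<delta> a])"
  using br_commutator[of "V # Vs" a] by (simp add: algebra_simps)

text \<open>By Leibniz and \<open>br_move\<close>, each contraction gives two neighbouring terms
  \<open>t\<close> and one full bracket, so the sum telescopes. The final \<open>t\<close> is
  written with \<open>last\<close>, since its entry is \<open>V\<close> itself if \<open>bs\<close>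
  is empty; so it matches \<open>br_move_cyclic\<close>.\<close>

lemma br_contract_sum:
  assumes "length bs = m"
  shows "(\<Sum>j<m. (- 1) ^ j * br (V # map \<delta> (contract j (bs @ [z])))) =
    br ((V * \<pi> (hd (bs @ [z]))) # map \<delta> (tl (bs @ [z])))
    - (- 1) ^ m * br (butlast (V # map \<delta> bs) @ [last (V # map \<delta> bs) * \<pi> z])
    + (if odd m then br (V # map \<delta> bs @ [\<delta> z]) else 0)"
proof -
  define cs where "cs = bs @ [z]"
  define L where "L = V # map \<delta> cs"
  \<comment> \<open>\<open>L\<close> starts with \<open>V\<close>, so \<open>L ! j\<close> stands
    just before \<open>\<delta> (cs ! j)\<close>. In \<open>t j\<close> that commutator is replaced
    by a right factor \<open>\<pi> (cs ! j)\<close> of its predecessor.\<close>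
  define t where "t j = br (take j L @ (L ! j * \<pi> (cs ! j)) # drop (j + 2) L)" for j
  have len: "length cs = Suc m" using assms by (simp add: cs_def)
  have "br (V # map \<delta> (contract j cs)) = t j + t (Suc j) + br L" if "j < m" for j
  proof -
    define us b c ws where "us = take j cs" and "b = cs ! j" and "c = cs ! Suc j"
      and "ws = drop (j + 2) cs"
    have cs: "cs = us @ b # c # ws" and us: "length us = j"
      using that len
      by (auto simp: us_def b_def c_def ws_def Cons_nth_drop_Suc)
    \<comment> \<open>\<open>W\<close> is the entry before \<open>\<delta> b\<close>:
      \<open>V\<close> if \<open>j = 0\<close>, a commutator otherwise.\<close>
    obtain us' W where us': "V # map \<delta> us = us' @ [W]"
      by (metis neq_Nil_conv rev_exhaust)
    have L: "L = us' @ W # \<delta> b # \<delta> c # map \<delta> ws"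
      using us' by (simp add: L_def cs flip: append_Cons)
    have len': "length us' = j" using arg_cong[OF us', of length] us by simp
    have tj: "t j = br (us' @ (W * \<pi> b) # \<delta> c # map \<delta> ws)"
      unfolding t_def L using len' us by (simp add: cs nth_append)
    have tSj: "t (Suc j) = br (us' @ W # (\<delta> b * \<pi> c) # map \<delta> ws)"
      unfolding t_def L using len' us by (simp add: cs nth_append)
    have "br (V # map \<delta> (contract j cs)) =
        br ((us' @ [W]) @ (\<delta> b * \<pi> c + \<pi> b * \<delta> c) # map \<delta> ws)"
      by (simp add: cs contract_append us \<delta>_mult flip: us')
    also have "\<dots> = t (Suc j) + br (us' @ W # (\<pi> b * \<delta> c) # map \<delta> ws)"
      by (subst br_add) (simp add: tSj)
    also have "\<dots> = t j + t (Suc j) + br L"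
      unfolding br_move by (simp add: tj L)
    finally show ?thesis .
  qed
  then have "(\<Sum>j<m. (- 1) ^ j * br (V # map \<delta> (contract j cs))) =
      t 0 - (- 1) ^ m * t m + (if odd m then br L else 0)"
    using sum_alternating_telescope[of t "br L" m] by simp
  moreover have "t 0 = br ((V * \<pi> (hd cs)) # map \<delta> (tl cs))"
    using len by (cases cs) (simp_all add: t_def L_def)
  moreover have "t m = br (butlast (V # map \<delta> bs) @ [last (V # map \<delta> bs) * \<pi> z])"
  proof -
    have "last (V # map \<delta> bs) = L ! m"
      using assms by (cases bs rule: rev_cases) (auto simp: L_def cs_def nth_append)
    moreover have "butlast (V # map \<delta> bs) = take m L"
      using assms by (simp add: L_def cs_def butlast_conv_take take_Cons')
    moreover have "cs ! m = z" by (simp add: cs_def flip: assms)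
    moreover have "drop (m + 2) L = []" using len by (simp add: L_def)
    ultimately show ?thesis by (simp add: t_def)
  qed
  ultimately show ?thesis by (simp add: cs_def L_def)
qed

section \<open>The cochains \<open>phi\<close> and their images under \<open>connes_B0\<close>, for
  an abstract derivation\<close>

definition ch :: "nat \<Rightarrow> 'a list \<Rightarrow> complex" where
  "ch n as = (if n = 0 then 0 else br ((\<pi> (as ! 0) * \<delta> (as ! 1)) # map \<delta> (drop 2 as)))"

lemma ch_Cons [simp]: "n > 0 \<Longrightarrow> ch n (a # b # cs) = br ((\<pi> a * \<delta> b) # map \<delta> cs)"
  by (simp add: ch_def)

text \<open>As \<open>\<pi> 1 = 1\<close>, applying \<open>connes_B0\<close> leaves a bracket of
  commutators alone, which is cyclic in its arguments.\<close>

lemma ch_one: "n > 0 \<Longrightarrow> as \<noteq> [] \<Longrightarrow> ch n (1 # as) = br (map \<delta> as)"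
  by (cases as) (simp_all add: \<pi>_one)

lemma length_Suc_ConsE:
  assumes "length as = n + 1" "n \<noteq> 0"
  obtains a b cs where "as = a # b # cs"
  using assms by (cases as; cases "tl as") auto

lemma cochain_ch: "cochain n (ch n)"
proof (cases "n = 0")
  case True
  then show ?thesis by (simp add: cochain_def multilinear_def ch_def)
next
  case n: False
  have "multilinear (n + 1) (ch n)"
    unfolding multilinear_def
  proof (intro allI impI)
    fix xs :: "'a list" and i assume *: "length xs = n + 1 \<and> i < n + 1"
    then obtain a b cs where xs: "xs = a # b # cs"
      using n by (elim conjE length_Suc_ConsE)
    \<comment> \<open>Arguments 0 and 1 share slot 0 of the bracket; argument \<open>k + 2\<close>
      sits in slot \<open>k + 1\<close>.\<close>
    consider "i = 0" | "i = 1" | k where "i = Suc (Suc k)" "k < length cs"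
      using * xs by (cases i; cases "i - 1") auto
    then show "(\<forall>x y. ch n (xs[i := x + y]) = ch n (xs[i := x]) + ch n (xs[i := y])) \<and>
        (\<forall>c x. ch n (xs[i := c *\<^sub>C x]) = c * ch n (xs[i := x]))"
    proof cases
      case 1
      then show ?thesis using n br_update_scaleC[of 0 "_ # _"]
        by (simp add: xs \<pi>_add \<pi>_scaleC distrib_right mult_scaleC_left br_add_hd)
    next
      case 2
      then show ?thesis using n br_update_scaleC[of 0 "_ # _"]
        by (simp add: xs \<delta>_add \<delta>_scaleC distrib_left mult_scaleC_right br_add_hd)
    next
      case 3
      then show ?thesis
        using n br_update_add[of "Suc k" "(\<pi> a * \<delta> b) # map \<delta> cs"]
          br_update_scaleC[of "Suc k" "(\<pi> a * \<delta> b) # map \<delta> cs"]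
        by (simp add: xs map_update \<delta>_add \<delta>_scaleC)
    qed
  qed
  moreover have "ch n as = 0"
    if len: "length as = n + 1" and j: "1 \<le> j" "j \<le> n" "as ! j = 1" for as j
  proof -
    obtain a b cs where as: "as = a # b # cs"
      using n by (rule length_Suc_ConsE[OF len])
    consider "j = 1" | k where "j = Suc (Suc k)" "k < length cs"
      using len j(1,2) as by (cases j; cases "j - 1") auto
    then have "b = 1 \<or> 1 \<in> set cs"
      using j(3) as by cases (auto, metis nth_mem)
    then have "0 \<in> set ((\<pi> a * \<delta> b) # map \<delta> cs)"
      using \<delta>_one by force
    then show ?thesis using n as by (simp add: br_zero)
  qed
  ultimately show ?thesis unfolding cochain_def by blast
qed

lemma cochain_br: "cochain n (\<lambda>as. br (map \<delta> as))"
proof -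
  have "multilinear (n + 1) (\<lambda>as. br (map \<delta> as))"
    unfolding multilinear_def
    by (simp add: map_update \<delta>_add \<delta>_scaleC br_update_add br_update_scaleC)
  moreover have "br (map \<delta> as) = 0" if "length as = n + 1" "j \<le> n" "as ! j = 1" for as j
  proof -
    have "1 \<in> set as" using that by (metis Suc_eq_plus1 less_Suc_eq_le nth_mem)
    then show ?thesis using br_zero[of "map \<delta> as"] \<delta>_one by force
  qed
  ultimately show ?thesis unfolding cochain_def by blast
qed

section \<open>Hochschild coboundaries of \<open>ch n\<close> and of the bracket of
  commutators\<close>

lemma length_Suc_Suc_snocE:
  assumes "length as = Suc (Suc m)"
  obtains a bs z where "as = a # bs @ [z]" "length bs = m"
proof -
  from assms obtain a cs where "as = a # cs" "length cs = Suc m"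
    by (auto simp: length_Suc_conv)
  then show ?thesis using that
    by (cases cs rule: rev_cases) auto
qed

text \<open>Only copies of \<open>ch (n + 1)\<close> survive: one from the telescoped sum if
  \<open>n\<close> is even, and one from the cyclic term with sign \<open>(- 1) ^ (n + 1)\<close>.
  They cancel for even \<open>n\<close>; for odd \<open>n\<close> the cyclic one remains.\<close>

lemma hoch_b_ch:
  assumes "length as = n + 2" "n > 0"
  shows "hoch_b n (ch n) as = (if even n then 0 else ch (n + 1) as)"
proof -
  obtain m where m: "n = Suc m" using assms(2) gr0_implies_Suc by blast
  from assms(1) m obtain a0 cs where cs: "as = a0 # cs" "length cs = Suc (Suc m)"
    by (auto simp: length_Suc_conv)
  from length_Suc_Suc_snocE[OF cs(2)] obtain a1 bs z
    where bs: "cs = a1 # bs @ [z]" "length bs = m" .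
  define V where "V = \<pi> a0 * \<delta> a1"
  \<comment> \<open>The argument after \<open>a1\<close>, which is \<open>z\<close> itself if
    \<open>bs\<close> is empty.\<close>
  define h where "h = hd (bs @ [z])"
  define r where "r = tl (bs @ [z])"
  have hr: "bs @ [z] = h # r" by (cases bs) (simp_all add: h_def r_def)
  have as: "as = a0 # a1 # bs @ [z]" using cs bs by simp
  \<comment> \<open>Contractions 0 and 1 touch the first slot, where
    \<open>\<pi> a0 * \<delta> a1\<close> is not a plain commutator; from 2 on,
    \<open>br_contract_sum\<close> applies.\<close>
  have "(\<Sum>j=0..n. (- 1) ^ j * ch n (contract j as)) =
      ch n (contract 0 as) - ch n (contract 1 as) +
      (\<Sum>j<m. (- 1) ^ j * ch n (contract (Suc (Suc j)) as))"
    unfolding m atLeast0AtMost lessThan_Suc_atMost[symmetric] sum_alternating_shift by simp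
  also have "ch n (contract 0 as) = br ((\<pi> a0 * \<pi> a1 * \<delta> h) # map \<delta> r)"
    using m by (simp add: as hr \<pi>_mult)
  also have "ch n (contract 1 as) =
      br ((V * \<pi> h) # map \<delta> r) + br ((\<pi> a0 * \<pi> a1 * \<delta> h) # map \<delta> r)"
    using m by (simp add: as hr V_def \<delta>_mult distrib_left br_add_hd mult.assoc)
  also have "(\<Sum>j<m. (- 1) ^ j * ch n (contract (Suc (Suc j)) as)) =
      br ((V * \<pi> h) # map \<delta> r)
      - (- 1) ^ m * br (butlast (V # map \<delta> bs) @ [last (V # map \<delta> bs) * \<pi> z])
      + (if odd m then br (V # map \<delta> bs @ [\<delta> z]) else 0)"
    using br_contract_sum[OF bs(2), of V z] m by (simp add: as V_def h_def r_def)
  also have "br (V # map \<delta> bs @ [\<delta> z]) = ch (n + 1) as"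
    by (simp add: as V_def)
  finally have "(\<Sum>j=0..n. (- 1) ^ j * ch n (contract j as)) =
      - ((- 1) ^ m * br (butlast (V # map \<delta> bs) @ [last (V # map \<delta> bs) * \<pi> z]))
      + (if odd m then ch (n + 1) as else 0)"
    by simp
  moreover have "ch n ((as ! (n + 1) * as ! 0) # drop 1 (take (n + 1) as)) =
      br (butlast (V # map \<delta> bs) @ [last (V # map \<delta> bs) * \<pi> z]) + ch (n + 1) as"
  proof -
    have "ch n ((as ! (n + 1) * as ! 0) # drop 1 (take (n + 1) as)) =
        br ((\<pi> z * V) # map \<delta> bs)"
      using m bs(2) by (simp add: as V_def \<pi>_mult nth_append mult.assoc)
    then show ?thesis by (simp only: br_move_cyclic) (simp add: as V_def)
  qed
  ultimately show ?thesis
    unfolding hoch_b_contract by (simp add: m algebra_simps)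
qed

text \<open>Contraction 0 and the cyclic term each yield one \<open>ch (n + 1)\<close>: Leibniz on
  \<open>a h\<close> produces \<open>\<pi> a * \<delta> h\<close>, and so does
  \<open>\<delta> z * \<pi> a\<close> after a move across the seam. \<open>T\<close> cancels, and
  one full bracket \<open>C\<close> is left over.\<close>

lemma hoch_b_br:
  assumes "length as = n + 2" "odd n"
  shows "hoch_b n (\<lambda>as. br (map \<delta> as)) as = 2 * ch (n + 1) as - br (map \<delta> as)"
proof -
  from assms(1) obtain a bs z where as: "as = a # bs @ [z]" and bs: "length bs = n"
    using length_Suc_Suc_snocE[of as n] by auto
  define h where "h = hd (bs @ [z])"
  define r where "r = tl (bs @ [z])"
  define T where "T = br (butlast (\<delta> a # map \<delta> bs) @ [last (\<delta> a # map \<delta> bs) * \<pi> z])"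
  define C where "C = br (map \<delta> as)"
  have hr: "bs @ [z] = h # r" by (cases bs) (simp_all add: h_def r_def)
  have ch: "ch (n + 1) as = br ((\<pi> a * \<delta> h) # map \<delta> r)"
    by (simp add: as hr)
  have "(\<Sum>j=0..n. (- 1) ^ j * br (map \<delta> (contract j as))) =
      br (map \<delta> (contract 0 as)) - (\<Sum>j<n. (- 1) ^ j * br (map \<delta> (contract (Suc j) as)))"
    unfolding atLeast0AtMost lessThan_Suc_atMost[symmetric] sum_alternating_shift by simp
  also have "br (map \<delta> (contract 0 as)) = br ((\<delta> a * \<pi> h) # map \<delta> r) + ch (n + 1) as"
    unfolding ch by (simp add: as hr \<delta>_mult br_add_hd)
  also have "(\<Sum>j<n. (- 1) ^ j * br (map \<delta> (contract (Suc j) as))) =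
      br ((\<delta> a * \<pi> h) # map \<delta> r) + T + C"
    using br_contract_sum[OF bs, of "\<delta> a" z] assms(2)
    by (simp add: as h_def r_def T_def C_def)
  finally have "(\<Sum>j=0..n. (- 1) ^ j * br (map \<delta> (contract j as))) = ch (n + 1) as - T - C"
    by simp
  moreover have "br (map \<delta> ((as ! (n + 1) * as ! 0) # drop 1 (take (n + 1) as))) =
      (ch (n + 1) as - C) + (T + C)"
  proof -
    have "br (map \<delta> ((as ! (n + 1) * as ! 0) # drop 1 (take (n + 1) as))) =
        br ((\<delta> z * \<pi> a) # map \<delta> bs) + br ((\<pi> z * \<delta> a) # map \<delta> bs)"
      using bs by (simp add: as nth_append \<delta>_mult br_add_hd)
    also have "br ((\<pi> z * \<delta> a) # map \<delta> bs) = T + C"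
      by (simp only: br_move_cyclic T_def C_def) (simp add: as)
    also have "br ((\<delta> z * \<pi> a) # map \<delta> bs) = ch (n + 1) as - C"
    \<comment> \<open>Rule (II) is read backwards here: starting from
      \<open>\<pi> a * \<delta> h\<close> in front, \<open>a\<close> moves to the right of
      \<open>\<delta> z\<close>, and the extra bracket rotates to \<open>C\<close>.\<close>
    proof -
      have "butlast (\<delta> h # map \<delta> r) = map \<delta> bs" "last (\<delta> h # map \<delta> r) = \<delta> z"
        using arg_cong[OF hr, of "\<lambda>l. butlast (map \<delta> l)"] arg_cong[OF hr, of "\<lambda>l. last (map \<delta> l)"]
        by simp_all
      moreover have "br ((\<delta> h # map \<delta> r) @ [\<delta> a]) = C"
        using br_append_commute[of "\<delta> h # map \<delta> r" "[\<delta> a]"] by (simp add: C_def as hr)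
      ultimately show ?thesis
        using br_append_commute[of "map \<delta> bs" "[\<delta> z * \<pi> a]"]
        by (simp only: ch br_move_cyclic) simp
    qed
    finally show ?thesis .
  qed
  ultimately show ?thesis
    unfolding hoch_b_contract using assms(2) by (simp add: C_def)
qed

text \<open>Rotating the arguments rotates a bracket of commutators, which rule (I) leaves
  unchanged.\<close>

lemma connes_B_ch:
  assumes "length as = n + 1"
  shows "connes_B n (ch (n + 1)) as = (if even n then of_nat (n + 1) * br (map \<delta> as) else 0)"
proof (rule connes_B_cyclic)
  fix j
  show "ch (n + 1) (1 # rotate j as) = br (map \<delta> as)"
    using assms by (subst ch_one) (auto simp: br_rotate simp flip: rotate_map)
qed

text \<open>The cochain \<open>psi\<close>, indexed by its degree \<open>n = 2 * k - 1\<close>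
  instead of \<open>k\<close>.\<close>

definition psi_ch :: "nat \<Rightarrow> 'a list \<Rightarrow> complex" where
  "psi_ch n as = ch n as - 1 / 2 * connes_B0 (ch (n + 1)) as"

lemma psi_ch_eq: "length as = n + 1 \<Longrightarrow> psi_ch n as = ch n as - 1 / 2 * br (map \<delta> as)"
  unfolding psi_ch_def connes_B0_def by (subst ch_one) auto

lemma cochain_psi_ch: "cochain n (psi_ch n)"
  by (rule cochain_cong[OF _ cochain_diff[OF cochain_ch cochain_mult[OF cochain_br]]])
    (rule psi_ch_eq)

text \<open>The weight 1/2 is what cancels \<open>ch (n + 1)\<close>: it occurs once in the
  coboundary of \<open>ch n\<close> and twice in that of the correction.\<close>

lemma hoch_b_psi_ch:
  assumes "length as = n + 2" "odd n"
  shows "hoch_b n (psi_ch n) as = 1 / 2 * br (map \<delta> as)"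
proof -
  have "hoch_b n (psi_ch n) as = hoch_b n (\<lambda>as. ch n as - 1 / 2 * br (map \<delta> as)) as"
    using assms(1) by (intro hoch_b_cong psi_ch_eq)
  also have "\<dots> = ch (n + 1) as - 1 / 2 * (2 * ch (n + 1) as - br (map \<delta> as))"
    using assms(2) hoch_b_ch[OF assms(1) odd_pos[OF assms(2)]]
    by (simp only: hoch_b_diff hoch_b_mult hoch_b_br[OF assms] if_False)
  finally show ?thesis by (simp add: algebra_simps)
qed

text \<open>The correction drops out, because \<open>\<delta> 1 = 0\<close> kills a bracket of
  commutators that has a unit among its arguments.\<close>

lemma connes_B_psi_ch:
  assumes "length as = n + 1" "even n"
  shows "connes_B n (psi_ch (n + 1)) as = of_nat (n + 1) * br (map \<delta> as)"
proof -
  have "psi_ch (n + 1) (1 # bs) = ch (n + 1) (1 # bs)" if "length bs = n + 1" for bs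
    using that by (simp add: psi_ch_eq \<delta>_one br_zero)
  then have "connes_B n (psi_ch (n + 1)) as = connes_B n (ch (n + 1)) as"
    using assms(1) by (intro connes_B_cong)
  then show ?thesis using assms connes_B_ch[of as n] by simp
qed

end

section \<open>The derivation of a spectral triple\<close>

lemma bop_eq_on_dense:
  assumes "closure S = UNIV" "\<And>x. x \<in> S \<Longrightarrow> bop_apply A x = bop_apply B x"
  shows "A = B"
proof -
  have cont: "continuous_on UNIV (bop_apply T)" for T :: "'a bop"
    using bop_apply[of T] by (intro linear_continuous_on) simp
  have "closed {x. bop_apply A x = bop_apply B x}"
    by (intro closed_Collect_eq cont)
  then have "closure S \<subseteq> {x. bop_apply A x = bop_apply B x}"
    using assms(2) by (intro closure_minimal) auto
  then show ?thesis using assms(1) by (auto simp flip: bop_apply_inject)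
qed

context
  fixes \<pi> :: "'a :: complex_star_algebra \<Rightarrow> 'h :: complex_hilbert bop"
    and domD :: "'h set" and D :: "'h \<Rightarrow> 'h"
  assumes triple: "spectral_triple \<pi> domD D"
begin

text \<open>Density of \<open>domD\<close> makes the bounded extension unique, so the
  \<open>THE\<close> in \<open>commD\<close> denotes whichever extension has been found.\<close>

lemma commD_eqI: "extends_commutator domD D (\<pi> a) C \<Longrightarrow> commD \<pi> domD D a = C"
  unfolding commD_def
proof (rule the_equality)
  fix C' assume *: "extends_commutator domD D (\<pi> a) C" "extends_commutator domD D (\<pi> a) C'"
  have "closure domD = UNIV" using triple by (simp add: spectral_triple_def self_adjoint_def)
  then show "C' = C"
    using * by (intro bop_eq_on_dense) (auto simp: extends_commutator_def)
qed

lemma extends_commD: "extends_commutator domD D (\<pi> a) (commD \<pi> domD D a)"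
  using triple commD_eqI unfolding spectral_triple_def by metis

lemma rep_in_dom: "x \<in> domD \<Longrightarrow> bop_apply (\<pi> a) x \<in> domD"
  using extends_commD by (auto simp: extends_commutator_def)

lemma apply_commD:
  "x \<in> domD \<Longrightarrow> bop_apply (commD \<pi> domD D a) x = D (bop_apply (\<pi> a) x) - bop_apply (\<pi> a) (D x)"
  using extends_commD by (auto simp: extends_commutator_def)

text \<open>By \<open>commD_eqI\<close> each right-hand side need only be checked on
  \<open>domD\<close>. For products this uses that \<open>\<pi> b\<close> maps \<open>domD\<close>
  into itself.\<close>

lemma commD_rules:
  shows commD_add: "commD \<pi> domD D (a + b) = commD \<pi> domD D a + commD \<pi> domD D b"
    and commD_scaleC: "commD \<pi> domD D (c *\<^sub>C a) = c *\<^sub>C commD \<pi> domD D a"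
    and commD_mult: "commD \<pi> domD D (a * b) =
      commD \<pi> domD D a * \<pi> b + \<pi> a * commD \<pi> domD D b"
proof -
  have rep: "\<pi> (a + b) = \<pi> a + \<pi> b" "\<pi> (c *\<^sub>C a) = c *\<^sub>C \<pi> a" "\<pi> (a * b) = \<pi> a * \<pi> b"
    using triple by (simp_all add: spectral_triple_def star_representation_def)
  have D: "x + y \<in> domD" "D (x + y) = D x + D y" "c *\<^sub>C x \<in> domD" "D (c *\<^sub>C x) = c *\<^sub>C D x"
    if "x \<in> domD" "y \<in> domD" for x y c
    using triple that by (simp_all add: spectral_triple_def self_adjoint_def linear_operator_on_def)
  have diff: "bop_apply T (x - y) = bop_apply T x - bop_apply T y" for T :: "'h bop" and x y
    using bop_apply[of T] by (auto intro: linear_diff bounded_linear.linear)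
  show "commD \<pi> domD D (a + b) = commD \<pi> domD D a + commD \<pi> domD D b"
    by (rule commD_eqI)
      (auto simp: extends_commutator_def rep plus_bop.rep_eq rep_in_dom apply_commD D)
  show "commD \<pi> domD D (c *\<^sub>C a) = c *\<^sub>C commD \<pi> domD D a"
    by (rule commD_eqI)
      (auto simp: extends_commutator_def rep scaleC_bop.rep_eq rep_in_dom apply_commD D
        scaleC_diff_right)
  show "commD \<pi> domD D (a * b) = commD \<pi> domD D a * \<pi> b + \<pi> a * commD \<pi> domD D b"
    by (rule commD_eqI)
      (auto simp: extends_commutator_def rep times_bop.rep_eq plus_bop.rep_eq rep_in_dom
        apply_commD diff)
qed

end

text \<open>The odd relations in positive degree hold outright. The one in degree 0 says that the
  bracket of a single commutator vanishes, hence the equivalence at the end.\<close>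

theorem proposition3p5:
  fixes \<pi> :: "'a :: complex_star_algebra \<Rightarrow> 'h :: complex_hilbert bop"
    and domD :: "'h set" and D :: "'h \<Rightarrow> 'h"
    and br :: "'h bop list \<Rightarrow> complex"
  assumes triple: "spectral_triple \<pi> domD D"
    and multilin: "\<And>n. n \<ge> 1 \<Longrightarrow> multilinear n br"
    and I: "\<And>Vs. length Vs \<ge> 1 \<Longrightarrow> br Vs = br (last Vs # butlast Vs)"
    and II: "\<And>Vs a. length Vs \<ge> 1 \<Longrightarrow>
      br ((\<pi> a * hd Vs) # tl Vs) - br (butlast Vs @ [last Vs * \<pi> a]) =
      br (Vs @ [commD \<pi> domD D a])"
  shows
    "even_bB_cocycle (\<lambda>k. phi \<pi> domD D br (2 * k)) \<and>
     (\<forall>k as. length as = 2 * k + 2 \<longrightarrow> hoch_b (2 * k) (phi \<pi> domD D br (2 * k)) as = 0) \<and>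
     (\<forall>k. cochain (2 * k + 1) (psi_tilde \<pi> domD D br (k + 1))) \<and>
     (\<forall>k as. length as = 2 * k + 3 \<longrightarrow>
        hoch_b (2 * k + 1) (psi_tilde \<pi> domD D br (k + 1)) as +
        connes_B (2 * k + 2) (psi_tilde \<pi> domD D br (k + 2)) as = 0) \<and>
     (odd_bB_cocycle (\<lambda>k. psi_tilde \<pi> domD D br (k + 1)) \<longleftrightarrow>
        (\<forall>a. br [commD \<pi> domD D a] = 0))"
proof -
  let ?\<delta> = "commD \<pi> domD D"
  interpret derivation_bracket \<pi> ?\<delta> br
  proof
    show "\<And>a b. \<pi> (a + b) = \<pi> a + \<pi> b" "\<And>c a. \<pi> (c *\<^sub>C a) = c *\<^sub>C \<pi> a"
      "\<And>a b. \<pi> (a * b) = \<pi> a * \<pi> b" "\<pi> 1 = 1"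
      using triple by (simp_all add: spectral_triple_def star_representation_def)
  qed (fact commD_rules[OF triple] multilin I II)+
  \<comment> \<open>The coefficient of \<open>psi_tilde (k + 1)\<close>; the shift makes the
    sequence start at \<open>k = 0\<close>.\<close>
  define c :: "nat \<Rightarrow> complex" where "c k = (- 1) ^ k * (fact k / fact (2 * k + 1))" for k
  have phi: "phi \<pi> domD D br n = ch n" for n
    by (simp add: phi_def ch_def fun_eq_iff)
  have tilde: "psi_tilde \<pi> domD D br (k + 1) = (\<lambda>as. c k * psi_ch (2 * k + 1) as)" for k
    by (simp add: psi_tilde_def psi_def psi_ch_def phi c_def fun_eq_iff)
  \<comment> \<open>This recursion is the cocycle relation: b contributes \<open>c k / 2\<close> and
    B contributes \<open>(2 * k + 3) * c (k + 1)\<close> times the same bracket.\<close>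
  have c_Suc: "c (Suc k) * of_nat (2 * k + 3) = - (c k / 2)" for k
  proof -
    have "fact (2 * Suc k + 1) = of_nat (2 * k + 3) * (2 * of_nat (Suc k)) * (fact (2 * k + 1) :: complex)"
      by (simp add: algebra_simps numeral_3_eq_3)
    moreover have "of_nat (2 * k + 3) \<noteq> (0 :: complex)" "of_nat (Suc k) \<noteq> (0 :: complex)"
      unfolding of_nat_eq_0_iff by simp_all
    ultimately show ?thesis
      unfolding c_def fact_Suc[of k] by (simp add: divide_simps del: of_nat_Suc of_nat_add of_nat_mult)
  qed
  have b_phi: "hoch_b (2 * k) (ch (2 * k)) as = 0" if "length as = 2 * k + 2" for k as
  proof (cases "k = 0")
    case True
    then show ?thesis by (simp add: hoch_b_def ch_def)
  qed (use that in \<open>simp add: hoch_b_ch\<close>)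
  \<comment> \<open>Both terms vanish separately: B lands in the odd degree
    \<open>2 * k + 1\<close>, where its signs cancel.\<close>
  have even: "even_bB_cocycle (\<lambda>k. ch (2 * k))"
    unfolding even_bB_cocycle_def using connes_B_ch[of _ "2 * _ + 1"]
    by (simp add: cochain_ch b_phi)
  have cochain: "cochain (2 * k + 1) (psi_tilde \<pi> domD D br (k + 1))" for k
    unfolding tilde by (intro cochain_mult cochain_psi_ch)
  have bB: "hoch_b (2 * k + 1) (psi_tilde \<pi> domD D br (k + 1)) as +
      connes_B (2 * k + 2) (psi_tilde \<pi> domD D br (k + 2)) as = 0"
    if "length as = 2 * k + 3" for k as
  proof -
    have "hoch_b (2 * k + 1) (psi_tilde \<pi> domD D br (k + 1)) as = c k * (1 / 2 * br (map ?\<delta> as))"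
      unfolding tilde hoch_b_mult using that by (subst hoch_b_psi_ch) simp_all
    moreover have "connes_B (2 * k + 2) (psi_tilde \<pi> domD D br (k + 2)) as =
        c (Suc k) * (of_nat (2 * k + 3) * br (map ?\<delta> as))"
      using that connes_B_psi_ch[of as "2 * k + 2"] tilde[of "Suc k"]
      by (simp add: connes_B_mult numeral_3_eq_3)
    ultimately show ?thesis
      using c_Suc[of k] by (simp only: flip: mult.assoc) (simp add: algebra_simps)
  qed
  have B0: "connes_B 0 (psi_tilde \<pi> domD D br (0 + 1)) as = br (map ?\<delta> as)"
    if "length as = 1" for as
    unfolding tilde connes_B_mult using that connes_B_psi_ch[of as 0] by (simp add: c_def)
  have "odd_bB_cocycle (\<lambda>k. psi_tilde \<pi> domD D br (k + 1)) \<longleftrightarrow>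
      (\<forall>as. length as = 1 \<longrightarrow> br (map ?\<delta> as) = 0)"
    unfolding odd_bB_cocycle_def using cochain bB B0 by (simp add: add.commute)
  also have "\<dots> \<longleftrightarrow> (\<forall>a. br [?\<delta> a] = 0)"
    by (auto simp: length_Suc_conv)
  finally show ?thesis
    unfolding phi using even b_phi cochain bB by blast
qed

end
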